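(* If there exists an extremally disconnected Hausdorff topological group of Ulam nonmeasurable cardinality which contains a countable family of open subgroups with nonopen intersection, then there exists a Boolean nondiscrete extremally disconnected Hausdorff topological group of cardinality at most $2^\omega$.
   Context: A topological space is extremally disconnected if the closure of any open set in it is open; a topological group is extremally disconnected if its underlying space is. A Boolean group is a group in which all nonidentity elements have order $2$. A cardinal $\kappa$ is Ulam measurable if there is a nonprincipal ultrafilter on $\kappa$ which is $\sigma$-complete (i.e., closed under countable intersections); otherwise it is Ulam nonmeasurable. *)

theory Defs
  imports "HOL-Analysis.Analysis" "HOL-Algebra.Multiplicative_Group"
begin

unbundle cardinal_syntax

locale topological_group = group G for G (structure) +
  fixes T :: "'a topology"
  assumes topspace_eq_carrier: "topspace T = carrier G"
    and continuous_mult: "continuous_map (prod_topology T T) T (\<lambda>(x, y). x \<otimes> y)"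
    and continuous_inv: "continuous_map T T (\<lambda>x. inv x)"

definition extremally_disconnected_space :: "'a topology \<Rightarrow> bool" where
  "extremally_disconnected_space T \<longleftrightarrow> (\<forall>U. openin T U \<longrightarrow> openin T (T closure_of U))"

definition boolean_group :: "('a, 'b) monoid_scheme \<Rightarrow> bool" where
  "boolean_group G \<longleftrightarrow>
     group G \<and> (\<forall>x \<in> carrier G. x \<noteq> \<one>\<^bsub>G\<^esub> \<longrightarrow> group.ord G x = 2)"

definition ultrafilter_on :: "'a set \<Rightarrow> 'a set set \<Rightarrow> bool" where
  "ultrafilter_on S \<F> \<longleftrightarrow>
     \<F> \<subseteq> Pow S \<and> S \<in> \<F> \<and> {} \<notin> \<F> \<and>
     (\<forall>A B. A \<in> \<F> \<longrightarrow> B \<in> \<F> \<longrightarrow> A \<inter> B \<in> \<F>) \<and>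
     (\<forall>A B. A \<in> \<F> \<longrightarrow> A \<subseteq> B \<longrightarrow> B \<subseteq> S \<longrightarrow> B \<in> \<F>) \<and>
     (\<forall>A. A \<subseteq> S \<longrightarrow> A \<in> \<F> \<or> S - A \<in> \<F>)"

definition nonprincipal_on :: "'a set \<Rightarrow> 'a set set \<Rightarrow> bool" where
  "nonprincipal_on S \<F> \<longleftrightarrow> \<not> (\<exists>x \<in> S. \<F> = {A. A \<subseteq> S \<and> x \<in> A})"

(* The empty subfamily is excluded because \<Inter>{} = UNIV, which need not be a subset of S. *)
definition sigma_complete :: "'a set set \<Rightarrow> bool" where
  "sigma_complete \<F> \<longleftrightarrow>
     (\<forall>\<A>. countable \<A> \<longrightarrow> \<A> \<noteq> {} \<longrightarrow> \<A> \<subseteq> \<F> \<longrightarrow> \<Inter>\<A> \<in> \<F>)"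

(* As in the HOL cardinal library, a cardinal is a relation, and its underlying set is its
   field; in particular Field |A| = A. *)
definition ulam_measurable :: "'a rel \<Rightarrow> bool" where
  "ulam_measurable \<kappa> \<longleftrightarrow>
     (\<exists>\<F>. ultrafilter_on (Field \<kappa>) \<F> \<and> nonprincipal_on (Field \<kappa>) \<F> \<and> sigma_complete \<F>)"

end

theory Submission
  imports Defs
begin

text \<open>By a theorem of Malykhin, one may pass to an open Boolean subgroup; let \<open>H\<^sub>n\<close> be a decreasing
  sequence of open subgroups of it with nonopen intersection. Fix a basis of the quotient by
  \<open>H\<^sub>n\<^sub>+\<^sub>1\<close>, and colour \<open>x \<in> H\<^sub>n - H\<^sub>n\<^sub>+\<^sub>1\<close> by the parity of the 2-adic valuation of its number of
  nonzero coordinates. The two colour classes are disjoint open sets, so by extremal disconnectedness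
  some neighbourhood of the identity misses one colour. Let \<open>V\<close> be a neighbourhood whose twofold
  and fourfold products lie in it. For fixed \<open>n\<close> and \<open>k\<close>, the coordinate sets of size \<open>k\<close> of elements of
  \<open>V \<inter> H\<^sub>n\<close> contain no sunflower with four petals, because passing from the sum of two petals to the sum
  of four doubles the number of coordinates and changes the colour. Hence there are finitely
  many such sets, and only countably many coordinates occur on \<open>V \<inter> H\<^sub>n\<close>. Reading off just
  these coordinates, for all \<open>n\<close>, is a homomorphism into the Boolean group of subsets of a countable
  set. Its kernel meets \<open>V\<close> inside the intersection of the \<open>H\<^sub>n\<close>, so it is not open, and the
  image with the quotient topology is as desired.\<close>

section \<open>Sunflowers in infinite families of finite sets of equal size\<close>

text \<open>The four sets form a sunflower with petals of size \<open>m\<close>: the common core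
  cancels in symmetric differences, leaving two or four disjoint petals. Induction on
  \<open>k\<close> strips off a point that lies in infinitely many members. If there is no such
  point, pairwise disjoint members can be chosen greedily.\<close>

lemma infinite_uniform_family_sym_diff:
  assumes "infinite F" and "\<And>A. A \<in> F \<Longrightarrow> finite A \<and> card A = k"
  shows "\<exists>A\<in>F. \<exists>B\<in>F. \<exists>C\<in>F. \<exists>D\<in>F. \<exists>m>0. card (sym_diff A B) = 2 * m \<and>
           card (sym_diff (sym_diff A B) (sym_diff C D)) = 4 * m"
  using assms
proof (induction k arbitrary: F)
  case 0
  then have "F \<subseteq> {{}}" by (metis card_0_eq insertI1 subsetI)
  with 0 show ?case by (meson finite.emptyI finite.insertI finite_subset)
next
  case (Suc k)
  show ?case
  proof (cases "\<exists>a. infinite {A \<in> F. a \<in> A}")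
    case True
    then obtain a where a: "infinite {A \<in> F. a \<in> A}" by blast
    define F' where "F' = (\<lambda>A. A - {a}) ` {A \<in> F. a \<in> A}"
    have "inj_on (\<lambda>A. A - {a}) {A \<in> F. a \<in> A}"
      by (rule inj_onI) blast
    then have "infinite F'"
      using a finite_imageD unfolding F'_def by blast
    moreover have "finite A \<and> card A = k" if "A \<in> F'" for A
      using that Suc.prems(2) by (auto simp: F'_def)
    ultimately obtain A B C D m where F': "A \<in> F'" "B \<in> F'" "C \<in> F'" "D \<in> F'" and
      m: "m > 0" "card (sym_diff A B) = 2 * m"
        "card (sym_diff (sym_diff A B) (sym_diff C D)) = 4 * m"
      using Suc.IH[of F'] by blast
    have *: "insert a E \<in> F \<and> a \<notin> E" if "E \<in> F'" for E
      using that by (auto simp: F'_def insert_absorb)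
    \<comment> \<open>The removed point belongs to the core, so restoring it does not affect the
      symmetric differences.\<close>
    have **: "sym_diff (insert a E) (insert a E') = sym_diff E E'" if "E \<in> F'" "E' \<in> F'" for E E'
      using *[OF that(1)] *[OF that(2)] by blast
    have "card (sym_diff (insert a A) (insert a B)) = 2 * m"
      "card (sym_diff (sym_diff (insert a A) (insert a B)) (sym_diff (insert a C) (insert a D))) = 4 * m"
      using F' m by (simp_all only: **)
    then show ?thesis
      using * F' m(1) by blast
  next
    case False
    \<comment> \<open>Each point now lies in only finitely many members, so a finite set meets only
      finitely many of them.\<close>
    have new: "\<exists>A\<in>F. A \<inter> Y = {}" if "finite Y" for Y
    proof (rule ccontr)
      assume "\<not> ?thesis"
      then have "F \<subseteq> (\<Union>a\<in>Y. {A \<in> F. a \<in> A})" by blast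
      with that False Suc.prems(1) show False
        by (meson finite_UN_I finite_subset)
    qed
    note fin = Suc.prems(2)
    obtain A where A: "A \<in> F" using new[of "{}"] by blast
    obtain B where B: "B \<in> F" "B \<inter> A = {}" using new[of A] fin[OF A] by blast
    obtain C where C: "C \<in> F" "C \<inter> (A \<union> B) = {}"
      using new[of "A \<union> B"] fin[OF A] fin[OF B(1)] by blast
    obtain D where D: "D \<in> F" "D \<inter> (A \<union> B \<union> C) = {}"
      using new[of "A \<union> B \<union> C"] fin[OF A] fin[OF B(1)] fin[OF C(1)] by blast
    have "sym_diff A B = A \<union> B" "sym_diff (sym_diff A B) (sym_diff C D) = A \<union> B \<union> (C \<union> D)"
      using B C D by blast+
    moreover have "card (A \<union> B) = 2 * Suc k" "card (C \<union> D) = 2 * Suc k"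
      using fin[OF A] fin[OF B(1)] fin[OF C(1)] fin[OF D(1)] B C D
      by (subst card_Un_disjoint; auto)+
    moreover from this have "card (A \<union> B \<union> (C \<union> D)) = 4 * Suc k"
      using fin[OF A] fin[OF B(1)] fin[OF C(1)] fin[OF D(1)] B C D
      by (subst card_Un_disjoint; auto)
    ultimately show ?thesis
      using A B(1) C(1) D(1)
      by (intro bexI[of _ A] bexI[of _ B] bexI[of _ C] bexI[of _ D] exI[of _ "Suc k"]) simp_all
  qed
qed

section \<open>Groups with trivial squares as vector spaces over the two-element field\<close>

lemma (in group) involutive_imp_comm_group:
  assumes "\<And>x. x \<in> carrier G \<Longrightarrow> x \<otimes> x = \<one>"
  shows "comm_group G"
proof (rule group_comm_groupI)
  fix x y assume xy: "x \<in> carrier G" "y \<in> carrier G"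
  have i: "inv z = z" if "z \<in> carrier G" for z
    using that assms by (simp add: inv_equality)
  show "x \<otimes> y = y \<otimes> x"
    using inv_mult_group[OF xy] i xy by simp
qed

text \<open>The elements of \<open>s x\<close> are the coordinates of the coset of \<open>x\<close> in a basis of \<open>G/N\<close>
  over the two-element field.\<close>
lemma (in group) involutive_coordinates:
  assumes invol: "\<And>x. x \<in> carrier G \<Longrightarrow> x \<otimes> x = \<one>" and N: "subgroup N G"
  shows "\<exists>s :: 'a \<Rightarrow> 'a set. (\<forall>x\<in>carrier G. finite (s x)) \<and>
    (\<forall>x\<in>carrier G. \<forall>y\<in>carrier G. s (x \<otimes> y) = sym_diff (s x) (s y)) \<and>
    (\<forall>x\<in>carrier G. s x = {} \<longleftrightarrow> x \<in> N)"
proof -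
  interpret comm_group G
    by (rule involutive_imp_comm_group[OF invol])
  interpret N: subgroup N G by (rule N)
  \<comment> \<open>\<open>P F\<close> is the vector that is the sum of the finite set
    \<open>F\<close>; common elements of two such sums cancel.\<close>
  define P where "P = finprod G (\<lambda>x. x)"
  have P_closed: "P F \<in> carrier G" if "F \<subseteq> carrier G" for F
    unfolding P_def using that by (intro finprod_closed) auto
  have P_Un: "P (A \<union> B) = P A \<otimes> P B"
    if "finite A" "finite B" "A \<inter> B = {}" "A \<subseteq> carrier G" "B \<subseteq> carrier G" for A B
    unfolding P_def using that by (intro finprod_Un_disjoint) auto
  have cancel: "(a \<otimes> c) \<otimes> (b \<otimes> c) = a \<otimes> b"
    if "a \<in> carrier G" "b \<in> carrier G" "c \<in> carrier G" for a b c
  proof -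
    have "(a \<otimes> c) \<otimes> (b \<otimes> c) = (a \<otimes> b) \<otimes> (c \<otimes> c)"
      using that by (simp add: m_ac)
    then show ?thesis using that invol by simp
  qed
  have P_sym_diff: "P A \<otimes> P B = P (sym_diff A B)"
    if "finite A" "finite B" "A \<subseteq> carrier G" "B \<subseteq> carrier G" for A B
  proof -
    have "P A = P (A - B) \<otimes> P (A \<inter> B)" "P B = P (B - A) \<otimes> P (A \<inter> B)"
      using that by (subst P_Un[symmetric]; auto intro!: arg_cong[of _ _ P])+
    then have "P A \<otimes> P B = P (A - B) \<otimes> P (B - A)"
      using that by (simp only:) (intro cancel P_closed; blast)
    also have "\<dots> = P (sym_diff A B)"
      using that by (subst P_Un[symmetric]; auto)
    finally show ?thesis .
  qed
  \<comment> \<open>Linear independence modulo \<open>N\<close>. The condition concerns finite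
    subsets only, so it passes to unions of chains and Zorn's lemma yields a basis
    \<open>X\<close>.\<close>
  define indep where
    "indep X \<longleftrightarrow> X \<subseteq> carrier G \<and> (\<forall>F\<subseteq>X. finite F \<longrightarrow> P F \<in> N \<longrightarrow> F = {})" for X
  have "\<Union>C \<in> Collect indep" if C: "subset.chain (Collect indep) C" for C
  proof -
    have ind: "indep X" if "X \<in> C" for X
      using C that by (auto simp: subset.chain_def)
    have "F = {}" if F: "F \<subseteq> \<Union>C" "finite F" "P F \<in> N" for F
    proof (rule ccontr)
      assume "F \<noteq> {}"
      then have "C \<noteq> {}" using F by blast
      then obtain X where "X \<in> C" "F \<subseteq> X"
        using finite_subset_Union_chain[OF F(2,1) _ C] by blast
      then show False using ind F \<open>F \<noteq> {}\<close> unfolding indep_def by blast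
    qed
    moreover have "\<Union>C \<subseteq> carrier G" using ind unfolding indep_def by blast
    ultimately show ?thesis unfolding indep_def by blast
  qed
  from subset_Zorn'[of "Collect indep", OF this] obtain X where
    X: "indep X" and max: "\<And>Y. indep Y \<Longrightarrow> X \<subseteq> Y \<Longrightarrow> Y = X" by blast
  have Xc: "X \<subseteq> carrier G" using X unfolding indep_def by blast
  \<comment> \<open>A maximal independent set spans modulo \<open>N\<close>: otherwise adjoining
    \<open>x\<close> would keep independence, so \<open>x\<close> would already be in
    \<open>X\<close>, and then \<open>F = {x}\<close> would do because \<open>x\<close> squares to
    the identity.\<close>
  have ex: "\<exists>F\<subseteq>X. finite F \<and> x \<otimes> P F \<in> N" if x: "x \<in> carrier G" for x
  proof (rule ccontr)
    assume no: "\<not> ?thesis"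
    have "indep (insert x X)"
      unfolding indep_def
    proof (intro conjI allI impI)
      show "insert x X \<subseteq> carrier G" using Xc x by blast
      fix F assume F: "F \<subseteq> insert x X" "finite F" "P F \<in> N"
      show "F = {}"
      proof (cases "x \<in> F")
        case True
        have "P F = P ({x} \<union> (F - {x}))" using True by (simp add: insert_absorb)
        also have "\<dots> = P {x} \<otimes> P (F - {x})"
          using F Xc x by (intro P_Un) auto
        also have "P {x} = x" using x by (simp add: P_def)
        finally show ?thesis using no F by (metis Diff_subset_conv finite_Diff insert_is_Un)
      next
        case False
        then show ?thesis using X F unfolding indep_def by blast
      qed
    qed
    with max have "x \<in> X" by blast
    then show False using no x invol by (auto simp: P_def dest: spec[of _ "{x}"])
  qed
  then have "\<forall>x\<in>carrier G. \<exists>F. F \<subseteq> X \<and> finite F \<and> x \<otimes> P F \<in> N" by blast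
  then obtain s where s: "\<And>x. x \<in> carrier G \<Longrightarrow> s x \<subseteq> X \<and> finite (s x) \<and> x \<otimes> P (s x) \<in> N"
    by (metis (no_types, lifting))
  \<comment> \<open>Two coordinate sets of the same coset differ by a finite subset of
    \<open>X\<close> whose product lies in \<open>N\<close>, and independence makes this subset
    empty. Additivity of \<open>s\<close> will follow from this uniqueness.\<close>
  have uniq: "F = s x" if "x \<in> carrier G" "F \<subseteq> X" "finite F" "x \<otimes> P F \<in> N" for x F
  proof -
    have c: "F \<subseteq> carrier G" "s x \<subseteq> carrier G" using that s Xc by blast+
    have "(P F \<otimes> x) \<otimes> (P (s x) \<otimes> x) \<in> N"
      using that s c P_closed by (simp add: m_comm)
    then have "P F \<otimes> P (s x) \<in> N"
      using that c by (simp add: cancel P_closed)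
    then have "P (sym_diff F (s x)) \<in> N"
      using that s c by (simp add: P_sym_diff)
    then have "sym_diff F (s x) = {}"
      using X that s unfolding indep_def by (meson Diff_subset Un_least finite_Diff finite_UnI order_trans)
    then show ?thesis by blast
  qed
  show ?thesis
  proof (intro exI[of _ s] conjI ballI)
    fix x assume x: "x \<in> carrier G"
    show "finite (s x)" using s[OF x] by blast
    show "s x = {} \<longleftrightarrow> x \<in> N"
      using s[OF x] uniq[OF x, of "{}"] x by (auto simp: P_def)
    fix y assume y: "y \<in> carrier G"
    have c: "s x \<subseteq> carrier G" "s y \<subseteq> carrier G" using s x y Xc by blast+
    have "(x \<otimes> P (s x)) \<otimes> (y \<otimes> P (s y)) \<in> N" using s x y by simp
    then have "(x \<otimes> y) \<otimes> (P (s x) \<otimes> P (s y)) \<in> N"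
      using x y c P_closed by (simp add: m_ac)
    then have "(x \<otimes> y) \<otimes> P (sym_diff (s x) (s y)) \<in> N"
      using s x y c by (simp add: P_sym_diff)
    then show "s (x \<otimes> y) = sym_diff (s x) (s y)"
      using s x y by (intro uniq[symmetric]) auto
  qed
qed

section \<open>Extremally disconnected spaces and fixed points of involutions\<close>

lemma extremally_disconnected_space_open_subtopology:
  assumes "extremally_disconnected_space X" "openin X B"
  shows "extremally_disconnected_space (subtopology X B)"
  unfolding extremally_disconnected_space_def
proof (intro allI impI)
  fix U assume "openin (subtopology X B) U"
  then have U: "openin X U" "U \<subseteq> B"
    using assms(2) by (auto simp: openin_open_subtopology)
  then have "subtopology X B closure_of U = B \<inter> X closure_of U"
    by (simp add: closure_of_subtopology Int_absorb1)
  then show "openin (subtopology X B) (subtopology X B closure_of U)"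
    using assms U by (simp add: extremally_disconnected_space_def openin_subtopology_Int2)
qed

text \<open>An open set disjoint from a set is also disjoint from its closure. This is applied
  twice, the second time to the open set \<open>X closure_of V\<close>.\<close>

lemma extremally_disconnected_space_disjoint_closures:
  assumes "extremally_disconnected_space X" "openin X U" "openin X V" "U \<inter> V = {}"
  shows "X closure_of U \<inter> X closure_of V = {}"
proof -
  have "U \<inter> X closure_of V = {}"
    using assms by (simp add: openin_Int_closure_of_eq_empty)
  then have "X closure_of V \<inter> U = {}" by blast
  moreover have "openin X (X closure_of V)"
    using assms by (simp add: extremally_disconnected_space_def)
  ultimately have "X closure_of V \<inter> X closure_of U = {}"
    by (simp add: openin_Int_closure_of_eq_empty)
  then show ?thesis by blast
qed

lemma extremally_disconnected_involution_fixed_points_open: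
  assumes haus: "Hausdorff_space X" and ed: "extremally_disconnected_space X"
    and cont: "continuous_map X X f" and invol: "\<And>x. x \<in> topspace X \<Longrightarrow> f (f x) = x"
  shows "openin X {x \<in> topspace X. f x = x}"
proof -
  have fim: "f x \<in> topspace X" if "x \<in> topspace X" for x
    using cont that by (auto simp: continuous_map_def)
  have img: "f ` U = {x \<in> topspace X. f x \<in> U}" if "U \<subseteq> topspace X" for U
  proof (intro equalityI subsetI)
    fix x assume "x \<in> {x \<in> topspace X. f x \<in> U}"
    then show "x \<in> f ` U" using invol by (intro image_eqI[of _ _ "f x"]) auto
  qed (use that fim invol in auto)
  have img_open: "openin X (f ` U)" if "openin X U" for U
    using openin_continuous_map_preimage[OF cont that] img[OF openin_subset[OF that]] by simp
  define \<U> where "\<U> = {U. openin X U \<and> U \<inter> f ` U = {}}"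
  have "\<Union>C \<in> \<U>" if C: "subset.chain \<U> C" for C
  proof -
    have in_\<U>: "openin X A \<and> A \<inter> f ` A = {}" if "A \<in> C" for A
      using C that by (auto simp: subset.chain_def \<U>_def)
    have "\<Union>C \<inter> f ` \<Union>C = {}"
    proof (rule ccontr)
      assume "\<not> ?thesis"
      then obtain A B y where AB: "A \<in> C" "B \<in> C" "y \<in> B" "f y \<in> A" by blast
      then have "A \<subseteq> B \<or> B \<subseteq> A" using C by (auto simp: subset.chain_def)
      then show False using AB in_\<U>[of A] in_\<U>[of B] by blast
    qed
    moreover have "openin X (\<Union>C)" using in_\<U> by blast
    ultimately show ?thesis unfolding \<U>_def by blast
  qed
  from subset_Zorn'[of \<U>, OF this] obtain M where
    M\<U>: "M \<in> \<U>" and M_max: "\<forall>U\<in>\<U>. M \<subseteq> U \<longrightarrow> U = M" by (rule bexE)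
  have M: "openin X M" "M \<inter> f ` M = {}" using M\<U> by (simp_all add: \<U>_def)
  have max: "U = M" if "openin X U" "U \<inter> f ` U = {}" "M \<subseteq> U" for U
    using M_max that by (simp add: \<U>_def)
  have Mc: "M \<subseteq> topspace X" using M openin_subset by blast
  define K where "K = X closure_of M"
  have K: "openin X K" using ed M unfolding K_def extremally_disconnected_space_def by blast
  have Kc: "K \<subseteq> topspace X" by (simp add: K_def closure_of_subset_topspace)
  have "f ` M \<inter> M = {}" using M(2) by blast
  then have "f ` M \<inter> K = {}"
    using img_open[OF M(1)] by (simp add: K_def openin_Int_closure_of_eq_empty)
  then have "f ` K \<inter> M = {}" using invol Kc by force
  then have "f ` K \<inter> K = {}"
    using img_open[OF K] unfolding K_def by (simp add: openin_Int_closure_of_eq_empty)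
  then have "K = M"
    using K max[of K] closure_of_subset[OF Mc] unfolding K_def by blast
  then have clM: "closedin X M" by (metis K_def closedin_closure_of)
  then have "closedin X (f ` M)"
    using closedin_continuous_map_preimage[OF cont clM] img[OF Mc] by simp
  with clM have op: "openin X (topspace X - (M \<union> f ` M))" by blast
  have "{x \<in> topspace X. f x = x} = topspace X - (M \<union> f ` M)"
  proof (intro equalityI subsetI)
    fix x assume "x \<in> {x \<in> topspace X. f x = x}"
    then show "x \<in> topspace X - (M \<union> f ` M)"
      using M img[OF Mc] by auto
  next
    fix x assume x: "x \<in> topspace X - (M \<union> f ` M)"
    show "x \<in> {x \<in> topspace X. f x = x}"
    proof (rule ccontr)
      assume "x \<notin> {x \<in> topspace X. f x = x}"
      then have "f x \<noteq> x" using x by blast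
      then obtain A B where AB: "openin X A" "openin X B" "x \<in> A" "f x \<in> B" "A \<inter> B = {}"
        using haus x fim unfolding Hausdorff_space_def disjnt_def by (metis DiffD1)
      \<comment> \<open>On \<open>W\<close> the map \<open>f\<close> takes values in
        \<open>B\<close>, which is disjoint from \<open>W\<close>. Staying outside \<open>M\<close>
        and its image prevents collisions between \<open>W\<close> and \<open>M\<close>.\<close>
      define W where "W = A \<inter> {z \<in> topspace X. f z \<in> B} \<inter> (topspace X - (M \<union> f ` M))"
      have "openin X W"
        unfolding W_def using AB op openin_continuous_map_preimage[OF cont] by blast
      moreover have "x \<in> W" using AB x by (simp add: W_def)
      moreover have "(M \<union> W) \<inter> f ` (M \<union> W) = {}"
        using M(2) AB(5) img[OF Mc] by (auto simp: W_def)
      ultimately have "x \<in> M" using max[of "M \<union> W"] M(1) by blast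
      with x show False by blast
    qed
  qed
  with op show ?thesis by simp
qed

section \<open>Open sets, subgroups and neighbourhoods of the identity in topological groups\<close>

context topological_group
begin

lemma openin_left_translate:
  assumes "openin T U" "a \<in> carrier G"
  shows "openin T {x \<in> carrier G. a \<otimes> x \<in> U}"
proof -
  have "continuous_map T (prod_topology T T) (\<lambda>x. (a, x))"
    using assms by (simp add: continuous_map_pairwise o_def topspace_eq_carrier)
  from continuous_map_compose[OF this continuous_mult]
  have "continuous_map T T (\<lambda>x. a \<otimes> x)" by (simp add: o_def)
  from openin_continuous_map_preimage[OF this assms(1)] show ?thesis
    by (simp add: topspace_eq_carrier)
qed

text \<open>The set \<open>S\<close> is a union of left translates of \<open>V\<close>. With an open
  subgroup as \<open>V\<close>, this gives openness of every union of its left cosets.\<close>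

lemma openin_if_translation_closed:
  assumes "openin T V" "\<one> \<in> V" "S \<subseteq> carrier G" "\<And>x v. x \<in> S \<Longrightarrow> v \<in> V \<Longrightarrow> x \<otimes> v \<in> S"
  shows "openin T S"
proof (subst openin_subopen, intro ballI exI conjI)
  fix x assume x: "x \<in> S"
  then have xc: "x \<in> carrier G" using assms by blast
  show "openin T {y \<in> carrier G. inv x \<otimes> y \<in> V}"
    using assms xc by (intro openin_left_translate) auto
  show "x \<in> {y \<in> carrier G. inv x \<otimes> y \<in> V}" using assms xc by simp
  show "{y \<in> carrier G. inv x \<otimes> y \<in> V} \<subseteq> S"
  proof
    fix y assume y: "y \<in> {y \<in> carrier G. inv x \<otimes> y \<in> V}"
    then have "x \<otimes> (inv x \<otimes> y) \<in> S" using assms x by blast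
    then show "y \<in> S" using y xc by (simp add: m_assoc[symmetric])
  qed
qed

lemma openin_subgroup:
  assumes "subgroup S G" "openin T V" "\<one> \<in> V" "V \<subseteq> S"
  shows "openin T S"
proof (rule openin_if_translation_closed[OF assms(2,3)])
  show "S \<subseteq> carrier G" by (rule subgroup.subset[OF assms(1)])
  show "x \<otimes> v \<in> S" if "x \<in> S" "v \<in> V" for x v
    using subgroup.m_closed[OF assms(1)] that assms(4) by blast
qed

lemma neighbourhood_square:
  assumes "openin T U" "\<one> \<in> U"
  shows "\<exists>V. openin T V \<and> \<one> \<in> V \<and> V \<subseteq> U \<and> (\<forall>x\<in>V. \<forall>y\<in>V. x \<otimes> y \<in> U)"
proof -
  have "openin (prod_topology T T)
      {p \<in> topspace (prod_topology T T). (\<lambda>(x, y). x \<otimes> y) p \<in> U}" (is "openin _ ?P")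
    by (rule openin_continuous_map_preimage[OF continuous_mult assms(1)])
  moreover have "(\<one>, \<one>) \<in> ?P" using assms by (simp add: topspace_eq_carrier)
  ultimately obtain A B where AB: "openin T A" "openin T B" "\<one> \<in> A" "\<one> \<in> B" "A \<times> B \<subseteq> ?P"
    unfolding openin_prod_topology_alt by meson
  have "openin T (A \<inter> B \<inter> U)" using AB assms by blast
  moreover have "x \<otimes> y \<in> U" if "x \<in> A \<inter> B \<inter> U" "y \<in> A \<inter> B \<inter> U" for x y
    using that AB(5) by auto
  ultimately show ?thesis using AB assms by (intro exI[of _ "A \<inter> B \<inter> U"]) auto
qed

lemma topological_group_subgroup:
  assumes "subgroup B G"
  shows "topological_group (G\<lparr>carrier := B\<rparr>) (subtopology T B)"
proof -
  interpret B: subgroup B G by (rule assms)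
  interpret GB: group "G\<lparr>carrier := B\<rparr>" by (rule subgroup_imp_group[OF assms])
  have top: "topspace (subtopology T B) = B"
    using B.subset by (auto simp: topspace_eq_carrier)
  show ?thesis
  proof
    show "topspace (subtopology T B) = carrier (G\<lparr>carrier := B\<rparr>)" using top by simp
    show "continuous_map (prod_topology (subtopology T B) (subtopology T B)) (subtopology T B)
        (\<lambda>(x, y). x \<otimes>\<^bsub>G\<lparr>carrier := B\<rparr>\<^esub> y)"
      using continuous_map_from_subtopology[OF continuous_mult, of "B \<times> B"] top
      by (auto simp: continuous_map_in_subtopology prod_topology_subtopology
          subtopology_subtopology Times_Int_Times Int_absorb)
    have "continuous_map (subtopology T B) (subtopology T B) (\<lambda>x. inv x)"
      using continuous_map_from_subtopology[OF continuous_inv, of B] top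
      by (auto simp: continuous_map_in_subtopology)
    then show "continuous_map (subtopology T B) (subtopology T B)
        (\<lambda>x. inv\<^bsub>G\<lparr>carrier := B\<rparr>\<^esub> x)"
      by (rule continuous_map_eq) (use top m_inv_consistent[OF assms] in auto)
  qed
qed

text \<open>Malykhin's theorem: near the identity, where \<open>x\<inverse> = x\<close> also holds for products,
  elements commute.\<close>
lemma open_involutive_subgroup_exists:
  assumes "Hausdorff_space T" "extremally_disconnected_space T"
  shows "\<exists>B. subgroup B G \<and> openin T B \<and> (\<forall>x\<in>B. x \<otimes> x = \<one>)"
proof -
  define Z where "Z = {x \<in> carrier G. inv x = x}"
  have "openin T Z"
    using extremally_disconnected_involution_fixed_points_open[OF assms continuous_inv]
    by (simp add: Z_def topspace_eq_carrier)
  moreover have "\<one> \<in> Z" by (simp add: Z_def)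
  ultimately obtain V where V: "openin T V" "\<one> \<in> V" "V \<subseteq> Z" "\<And>x y. x \<in> V \<Longrightarrow> y \<in> V \<Longrightarrow> x \<otimes> y \<in> Z"
    using neighbourhood_square[of Z] by blast
  have Vc: "V \<subseteq> carrier G" using V Z_def by blast
  have inv_V: "inv v = v" if "v \<in> V" for v using that V Z_def by blast
  define B where "B = generate G V"
  have B: "subgroup B G" unfolding B_def by (rule generate_is_subgroup[OF Vc])
  have Bc: "B \<subseteq> carrier G" by (rule subgroup.subset[OF B])
  have VB: "V \<subseteq> B" unfolding B_def by (auto intro: generate.incl)
  have comm_V: "x \<otimes> y = y \<otimes> x" if "x \<in> V" "y \<in> V" for x y
    using V(4)[OF that] inv_mult_group[of x y] that Vc inv_V by (auto simp: Z_def)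
  \<comment> \<open>Commutativity spreads from the generators to \<open>B\<close> by two inductions,
    one for each factor.\<close>
  have comm_BV: "x \<otimes> v = v \<otimes> x" if "x \<in> B" "v \<in> V" for x v
    using that(1) unfolding B_def
  proof (induction rule: generate.induct)
    case (eng x y)
    have c: "x \<in> carrier G" "y \<in> carrier G" "v \<in> carrier G"
      using eng Bc that Vc unfolding B_def by auto
    then show ?case using eng.IH by (metis m_assoc)
  qed (use that Vc inv_V comm_V in auto)
  have comm_B: "x \<otimes> y = y \<otimes> x" if "x \<in> B" "y \<in> B" for x y
    using that(2) unfolding B_def
  proof (induction rule: generate.induct)
    case (eng y z)
    have c: "x \<in> carrier G" "y \<in> carrier G" "z \<in> carrier G"
      using eng Bc that unfolding B_def by auto
    then show ?case using eng.IH by (metis m_assoc)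
  qed (use that Bc inv_V comm_BV in auto)
  have "x \<otimes> x = \<one>" if "x \<in> B" for x
    using that unfolding B_def
  proof (induction rule: generate.induct)
    case (eng x y)
    have c: "x \<in> carrier G" "y \<in> carrier G" and xy: "x \<otimes> y = y \<otimes> x"
      using eng Bc comm_B unfolding B_def by auto
    have "(x \<otimes> y) \<otimes> (x \<otimes> y) = (x \<otimes> x) \<otimes> (y \<otimes> y)"
      using c xy by (metis m_assoc m_closed)
    then show ?case using eng.IH by simp
  next
    case (incl h)
    then show ?case using inv_V Vc by (metis r_inv subsetD)
  next
    case (inv h)
    then show ?case using inv_V Vc by (metis r_inv subsetD)
  qed auto
  then show ?thesis using B openin_subgroup[OF B V(1,2) VB] by blast
qed

section \<open>Images in groups of sets under symmetric difference\<close>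

text \<open>The image carries the quotient topology. Since the quotient map is open, continuity of
  multiplication and extremal disconnectedness descend. Open coordinates separate points, and the
  nonopen kernel prevents discreteness.\<close>

lemma boolean_image_of_extremally_disconnected:
  fixes \<Phi> :: "'a \<Rightarrow> 'c set"
  assumes ed: "extremally_disconnected_space T"
    and hom: "\<And>x y. x \<in> carrier G \<Longrightarrow> y \<in> carrier G \<Longrightarrow> \<Phi> (x \<otimes> y) = sym_diff (\<Phi> x) (\<Phi> y)"
    and coord: "\<And>j. openin T {x \<in> carrier G. j \<in> \<Phi> x}"
    and ker: "\<not> openin T {x \<in> carrier G. \<Phi> x = {}}"
  shows "\<exists>(Q :: 'c set monoid) S.
      topological_group Q S \<and> Hausdorff_space S \<and> extremally_disconnected_space S \<and>
      boolean_group Q \<and> S \<noteq> discrete_topology (carrier Q)"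
proof -
  define C where "C = \<Phi> ` carrier G"
  define Q :: "'c set monoid" where
    "Q = \<lparr>carrier = C, mult = (\<lambda>A B. sym_diff A B), one = {}\<rparr>"
  have Q_simps: "carrier Q = C" "A \<otimes>\<^bsub>Q\<^esub> B = sym_diff A B" "\<one>\<^bsub>Q\<^esub> = {}" for A B
    by (simp_all add: Q_def)
  have \<Phi>_one: "\<Phi> \<one> = {}" using hom[of \<one> \<one>] by simp
  have \<Phi>_inv: "\<Phi> (inv x) = \<Phi> x" if "x \<in> carrier G" for x
    using hom[OF that inv_closed[OF that]] that \<Phi>_one by auto
  have Q_closed: "sym_diff A B \<in> C" if "A \<in> C" "B \<in> C" for A B
  proof -
    obtain x y where xy: "x \<in> carrier G" "y \<in> carrier G" "A = \<Phi> x" "B = \<Phi> y"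
      using \<open>A \<in> C\<close> \<open>B \<in> C\<close> unfolding C_def by (elim imageE)
    then have "sym_diff A B = \<Phi> (x \<otimes> y)" using hom by simp
    then show ?thesis unfolding C_def using xy by simp
  qed
  have "{} \<in> C" using imageI[OF one_closed, of \<Phi>] \<Phi>_one by (simp add: C_def)
  then have group_Q: "group Q"
    using Q_closed by (intro groupI) (auto simp: Q_simps)
  interpret Q: group Q by (rule group_Q)
  have inv_Q: "inv\<^bsub>Q\<^esub> A = A" if "A \<in> C" for A
    using that by (intro Q.inv_equality) (auto simp: Q_simps)
  have boolean: "boolean_group Q"
    unfolding boolean_group_def
  proof (intro conjI ballI impI group_Q)
    fix A assume A: "A \<in> carrier Q" "A \<noteq> \<one>\<^bsub>Q\<^esub>"
    then have "A [^]\<^bsub>Q\<^esub> (2::nat) = \<one>\<^bsub>Q\<^esub>"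
      by (simp add: numeral_2_eq_2 Q_simps)
    then have "Q.ord A dvd 2" using A Q.pow_eq_id by blast
    then show "Q.ord A = 2" using A Q.ord_eq_1 two_is_prime_nat
      by (metis prime_nat_iff)
  qed
  define pre where "pre U = {x \<in> carrier G. \<Phi> x \<in> U}" for U
  define S where "S = topology (\<lambda>U. U \<subseteq> C \<and> openin T (pre U))"
  have "istopology (\<lambda>U. U \<subseteq> C \<and> openin T (pre U))"
    unfolding istopology_def
  proof (intro conjI allI impI)
    fix U V assume "U \<subseteq> C \<and> openin T (pre U)" "V \<subseteq> C \<and> openin T (pre V)"
    moreover have "pre (U \<inter> V) = pre U \<inter> pre V" by (auto simp: pre_def)
    ultimately show "U \<inter> V \<subseteq> C" "openin T (pre (U \<inter> V))" by auto
  next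
    fix \<K> assume "\<forall>K\<in>\<K>. K \<subseteq> C \<and> openin T (pre K)"
    moreover have "pre (\<Union>\<K>) = \<Union>(pre ` \<K>)" by (auto simp: pre_def)
    ultimately show "\<Union>\<K> \<subseteq> C" "openin T (pre (\<Union>\<K>))" by auto
  qed
  then have openin_S: "openin S U \<longleftrightarrow> U \<subseteq> C \<and> openin T (pre U)" for U
    by (simp add: S_def topology_inverse')
  have "pre C = topspace T" by (auto simp: pre_def C_def topspace_eq_carrier)
  then have top_S: "topspace S = C"
    using openin_S by (metis openin_subset openin_topspace subset_antisym subset_refl)
  have open_image: "openin S (\<Phi> ` A)" if A: "openin T A" for A
  proof -
    have Ac: "A \<subseteq> carrier G" using A openin_subset topspace_eq_carrier by blast
    \<comment> \<open>The saturation of \<open>A\<close> is the union of its translates by the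
      kernel.\<close>
    have "pre (\<Phi> ` A) = (\<Union>k\<in>{k \<in> carrier G. \<Phi> k = {}}. {x \<in> carrier G. k \<otimes> x \<in> A})"
    proof (intro equalityI subsetI)
      fix x assume "x \<in> pre (\<Phi> ` A)"
      then obtain a where a: "a \<in> A" "\<Phi> x = \<Phi> a" "x \<in> carrier G" unfolding pre_def by blast
      then have ac: "a \<in> carrier G" using Ac by blast
      then have "\<Phi> (a \<otimes> inv x) = {}" using a hom[of a "inv x"] \<Phi>_inv by simp
      moreover have "(a \<otimes> inv x) \<otimes> x = a" using a ac by (simp add: m_assoc)
      ultimately show "x \<in> (\<Union>k\<in>{k \<in> carrier G. \<Phi> k = {}}. {x \<in> carrier G. k \<otimes> x \<in> A})"
        using a ac by (intro UN_I[of "a \<otimes> inv x"]) auto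
    next
      fix x assume "x \<in> (\<Union>k\<in>{k \<in> carrier G. \<Phi> k = {}}. {x \<in> carrier G. k \<otimes> x \<in> A})"
      then obtain k where k: "k \<in> carrier G" "\<Phi> k = {}" "x \<in> carrier G" "k \<otimes> x \<in> A" by blast
      then have "\<Phi> (k \<otimes> x) = \<Phi> x" using hom by simp
      then show "x \<in> pre (\<Phi> ` A)" using k unfolding pre_def by (metis (no_types, lifting) imageI mem_Collect_eq)
    qed
    moreover have "openin T \<dots>" using A openin_left_translate by blast
    ultimately show ?thesis using Ac by (auto simp: openin_S C_def)
  qed
  have cont: "continuous_map T S \<Phi>"
    unfolding continuous_map_def top_S
    using openin_S by (auto simp: C_def topspace_eq_carrier pre_def)
  have mult: "continuous_map (prod_topology S S) S (\<lambda>(A, B). A \<otimes>\<^bsub>Q\<^esub> B)"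
    unfolding continuous_map_def
  proof (intro conjI allI impI)
    show "(\<lambda>(A, B). A \<otimes>\<^bsub>Q\<^esub> B) \<in> topspace (prod_topology S S) \<rightarrow> topspace S"
      using Q_closed by (auto simp: top_S Q_simps)
    fix U assume U: "openin S U"
    show "openin (prod_topology S S)
        {p \<in> topspace (prod_topology S S). (case p of (A, B) \<Rightarrow> A \<otimes>\<^bsub>Q\<^esub> B) \<in> U}" (is "openin _ ?P")
      unfolding openin_prod_topology_alt
    proof (intro allI impI)
      fix a b assume "(a, b) \<in> ?P"
      then have ab: "a \<in> C" "b \<in> C" "sym_diff a b \<in> U" by (auto simp: top_S Q_simps)
      then obtain x y where xy: "x \<in> carrier G" "y \<in> carrier G" "a = \<Phi> x" "b = \<Phi> y"
        unfolding C_def by blast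
      let ?R = "{p \<in> topspace (prod_topology T T). (\<lambda>(x, y). x \<otimes> y) p \<in> pre U}"
      have "openin (prod_topology T T) ?R"
        using U openin_S by (intro openin_continuous_map_preimage[OF continuous_mult]) blast
      moreover have "(x, y) \<in> ?R" using xy ab hom by (simp add: pre_def topspace_eq_carrier)
      ultimately obtain A B where AB: "openin T A" "openin T B" "x \<in> A" "y \<in> B" "A \<times> B \<subseteq> ?R"
        unfolding openin_prod_topology_alt by meson
      have "\<Phi> ` A \<times> \<Phi> ` B \<subseteq> ?P"
      proof
        fix p assume "p \<in> \<Phi> ` A \<times> \<Phi> ` B"
        then obtain u v where uv: "u \<in> A" "v \<in> B" "p = (\<Phi> u, \<Phi> v)" by blast
        then have "(u, v) \<in> ?R" using AB(5) by blast
        then have "u \<in> carrier G" "v \<in> carrier G" "\<Phi> (u \<otimes> v) \<in> U"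
          by (simp_all add: pre_def topspace_eq_carrier)
        then show "p \<in> ?P" using uv hom by (simp add: top_S Q_simps C_def)
      qed
      then show "\<exists>A' B'. openin S A' \<and> openin S B' \<and> a \<in> A' \<and> b \<in> B' \<and> A' \<times> B' \<subseteq> ?P"
        using open_image AB(1-4) xy by blast
    qed
  qed
  have "continuous_map S S (\<lambda>A. inv\<^bsub>Q\<^esub> A)"
    by (rule continuous_map_eq[OF continuous_map_id]) (simp add: top_S inv_Q)
  with mult have tg: "topological_group Q S"
    by (intro topological_group.intro topological_group_axioms.intro group_Q)
      (simp_all add: top_S Q_simps)
  have haus: "Hausdorff_space S"
    unfolding Hausdorff_space_def
  proof (intro allI impI)
    \<comment> \<open>The elements without coordinate \<open>j\<close> form a translate of those
      with it, by any \<open>a\<close> having this coordinate; if there is no such \<open>a\<close>,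
      they form the whole group.\<close>
    have sep: "openin S {A \<in> C. j \<in> A}" "openin S {A \<in> C. j \<notin> A}" for j
    proof -
      have p: "pre {A \<in> C. j \<in> A} = {x \<in> carrier G. j \<in> \<Phi> x}"
        "pre {A \<in> C. j \<notin> A} = {x \<in> carrier G. j \<notin> \<Phi> x}"
        by (auto simp: pre_def C_def)
      show "openin S {A \<in> C. j \<in> A}" using coord p by (auto simp: openin_S)
      have "openin T {x \<in> carrier G. j \<notin> \<Phi> x}"
      proof (cases "\<exists>a\<in>carrier G. j \<in> \<Phi> a")
        case True
        then obtain a where a: "a \<in> carrier G" "j \<in> \<Phi> a" by blast
        then have "{x \<in> carrier G. j \<notin> \<Phi> x} = {x \<in> carrier G. a \<otimes> x \<in> {x \<in> carrier G. j \<in> \<Phi> x}}"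
          using hom by auto
        then show ?thesis using openin_left_translate[OF coord a(1)] by simp
      next
        case False
        then have "{x \<in> carrier G. j \<notin> \<Phi> x} = topspace T" by (auto simp: topspace_eq_carrier)
        then show ?thesis by simp
      qed
      then show "openin S {A \<in> C. j \<notin> A}" using p by (auto simp: openin_S)
    qed
    fix A B assume AB: "A \<in> topspace S \<and> B \<in> topspace S \<and> A \<noteq> B"
    then obtain j where "(j \<in> A \<and> j \<notin> B) \<or> (j \<in> B \<and> j \<notin> A)" by blast
    then show "\<exists>U V. openin S U \<and> openin S V \<and> A \<in> U \<and> B \<in> V \<and> disjnt U V"
    proof
      assume "j \<in> A \<and> j \<notin> B"
      then show ?thesis using AB sep[of j] top_S
        by (intro exI[of _ "{A \<in> C. j \<in> A}"] exI[of _ "{A \<in> C. j \<notin> A}"]) (auto simp: disjnt_def)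
    next
      assume "j \<in> B \<and> j \<notin> A"
      then show ?thesis using AB sep[of j] top_S
        by (intro exI[of _ "{A \<in> C. j \<notin> A}"] exI[of _ "{A \<in> C. j \<in> A}"]) (auto simp: disjnt_def)
    qed
  qed
  have "extremally_disconnected_space S"
    unfolding extremally_disconnected_space_def
  proof (intro allI impI)
    fix U assume U: "openin S U"
    then have Uc: "U \<subseteq> C" "openin T (pre U)" by (simp_all add: openin_S)
    have "\<Phi> ` pre U = U" using Uc(1) by (auto simp: pre_def C_def)
    then have "\<Phi> ` (T closure_of pre U) \<subseteq> S closure_of U"
      using continuous_map_image_closure_subset[OF cont, of "pre U"] by simp
    \<comment> \<open>Here openness of the quotient map is used: a neighbourhood of \<open>x\<close>
      maps to a neighbourhood of \<open>y\<close>, which meets \<open>U\<close>, and a preimage of a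
      common point lies in \<open>pre U\<close>.\<close>
    moreover have "S closure_of U \<subseteq> \<Phi> ` (T closure_of pre U)"
    proof
      fix y assume y: "y \<in> S closure_of U"
      then obtain x where x: "x \<in> carrier G" "y = \<Phi> x"
        using closure_of_subset_topspace[of S U] top_S unfolding C_def by blast
      have "x \<in> T closure_of pre U"
        unfolding in_closure_of
      proof (intro conjI allI impI)
        show "x \<in> topspace T" using x by (simp add: topspace_eq_carrier)
        fix W assume W: "x \<in> W \<and> openin T W"
        then have "y \<in> \<Phi> ` W" "openin S (\<Phi> ` W)" using x open_image by blast+
        with y obtain z where z: "z \<in> U" "z \<in> \<Phi> ` W" unfolding in_closure_of by blast
        have "W \<subseteq> carrier G" using W openin_subset topspace_eq_carrier by blast
        with z show "\<exists>w. w \<in> pre U \<and> w \<in> W" unfolding pre_def by blast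
      qed
      with x show "y \<in> \<Phi> ` (T closure_of pre U)" by blast
    qed
    ultimately have "S closure_of U = \<Phi> ` (T closure_of pre U)" by blast
    then show "openin S (S closure_of U)"
      using open_image Uc ed by (simp add: extremally_disconnected_space_def)
  qed
  moreover have "S \<noteq> discrete_topology (carrier Q)"
  proof
    assume "S = discrete_topology (carrier Q)"
    then have "openin S {{}}" using \<open>{} \<in> C\<close> by (simp add: Q_simps)
    then show False using ker by (simp add: openin_S pre_def)
  qed
  ultimately show ?thesis using tg haus boolean by blast
qed

section \<open>Countably many coordinates for a decreasing sequence of open subgroups\<close>

lemma countable_coordinates_of_nonopen_Inter:
  fixes H :: "nat \<Rightarrow> 'a set"
  assumes ed: "extremally_disconnected_space T"
    and invol: "\<And>x. x \<in> carrier G \<Longrightarrow> x \<otimes> x = \<one>"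
    and sub: "\<And>n. subgroup (H n) G" and op: "\<And>n. openin T (H n)"
    and decr: "\<And>n. H (Suc n) \<subseteq> H n" and H0: "H 0 = carrier G"
    and nonopen: "\<not> openin T (\<Inter>n. H n)"
  shows "\<exists>\<Phi> :: 'a \<Rightarrow> nat set.
    (\<forall>x\<in>carrier G. \<forall>y\<in>carrier G. \<Phi> (x \<otimes> y) = sym_diff (\<Phi> x) (\<Phi> y)) \<and>
    (\<forall>j. openin T {x \<in> carrier G. j \<in> \<Phi> x}) \<and> \<not> openin T {x \<in> carrier G. \<Phi> x = {}}"
proof -
  have "\<forall>n. \<exists>s :: 'a \<Rightarrow> 'a set. (\<forall>x\<in>carrier G. finite (s x)) \<and>
    (\<forall>x\<in>carrier G. \<forall>y\<in>carrier G. s (x \<otimes> y) = sym_diff (s x) (s y)) \<and>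
    (\<forall>x\<in>carrier G. s x = {} \<longleftrightarrow> x \<in> H (Suc n))"
    using involutive_coordinates[OF invol sub] by blast
  from choice[OF this] obtain s :: "nat \<Rightarrow> 'a \<Rightarrow> 'a set" where
    s: "\<forall>n. (\<forall>x\<in>carrier G. finite (s n x)) \<and>
      (\<forall>x\<in>carrier G. \<forall>y\<in>carrier G. s n (x \<otimes> y) = sym_diff (s n x) (s n y)) \<and>
      (\<forall>x\<in>carrier G. s n x = {} \<longleftrightarrow> x \<in> H (Suc n))"
    by (rule exE)
  have s_fin: "finite (s n x)" if "x \<in> carrier G" for n x
    using s that by blast
  have s_mult: "s n (x \<otimes> y) = sym_diff (s n x) (s n y)"
    if "x \<in> carrier G" "y \<in> carrier G" for n x y
    using s that by simp
  have s_empty: "s n x = {} \<longleftrightarrow> x \<in> H (Suc n)" if "x \<in> carrier G" for n x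
    using s that by blast
  have Hc: "x \<in> carrier G" if "x \<in> H n" for x n
    using subgroup.subset[OF sub] that by blast
  have H_mult: "x \<otimes> y \<in> H n" if "x \<in> H n" "y \<in> H n" for x y n
    using subgroup.m_closed[OF sub that] .
  have H_one: "\<one> \<in> H n" for n using subgroup.one_closed[OF sub] .
  \<comment> \<open>Level \<open>n\<close> coordinates are constant on cosets of the open subgroup
    \<open>H (Suc n)\<close>, so sets described through them are open.\<close>
  have s_translate: "s n (x \<otimes> v) = s n x" if "x \<in> carrier G" "v \<in> H (Suc n)" for n x v
    using s_mult[of x v n] s_empty[of v n] Hc[OF that(2)] that by simp
  have level_unique: "n = m"
    if "x \<in> H n - H (Suc n)" "x \<in> H m - H (Suc m)" for x n m
  proof (rule ccontr)
    assume "n \<noteq> m"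
    then have "Suc n \<le> m \<or> Suc m \<le> n" by linarith
    then show False using lift_Suc_antimono_le[of H, OF decr] that by blast
  qed
  \<comment> \<open>Outside \<open>H (Suc n)\<close> the coordinate set is nonempty, so its size is
    positive and doubling it flips the colour.\<close>
  define colour where "colour n x \<longleftrightarrow> even (multiplicity 2 (card (s n x)))" for n x
  define U where "U i = (\<Union>n. {x \<in> H n - H (Suc n). colour n x = i})" for i
  have U_open: "openin T (U i)" for i
    unfolding U_def
  proof (intro openin_Union ballI, elim imageE, simp only:)
    fix n
    show "openin T {x \<in> H n - H (Suc n). colour n x = i}"
    proof (rule openin_if_translation_closed[OF op[of "Suc n"] H_one])
      fix x v assume x: "x \<in> {x \<in> H n - H (Suc n). colour n x = i}" and v: "v \<in> H (Suc n)"
      then have c: "x \<in> carrier G" "v \<in> carrier G" using Hc by blast+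
      have "s n (x \<otimes> v) = s n x" using s_translate c v by blast
      moreover from this have "x \<otimes> v \<notin> H (Suc n)"
        using s_empty[of x n] s_empty[of "x \<otimes> v" n] c x by simp
      moreover have "x \<otimes> v \<in> H n" using H_mult x v decr by blast
      ultimately show "x \<otimes> v \<in> {x \<in> H n - H (Suc n). colour n x = i}"
        using x by (simp add: colour_def)
    qed (use Hc in blast)
  qed
  have "U True \<inter> U False = {}"
  proof (rule ccontr)
    assume "\<not> ?thesis"
    then obtain x n m where "x \<in> H n - H (Suc n)" "colour n x = True"
      "x \<in> H m - H (Suc m)" "colour m x = False"
      unfolding U_def by blast
    then show False using level_unique by blast
  qed
  then have "T closure_of U True \<inter> T closure_of U False = {}"
    using extremally_disconnected_space_disjoint_closures[OF ed] U_open by blast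
  \<comment> \<open>The identity cannot lie in both closures; \<open>i\<close> is a colour absent
    near it.\<close>
  then obtain i where i: "\<one> \<notin> T closure_of U i" by blast
  define W where "W = carrier G - T closure_of U i"
  have "openin T W"
    unfolding W_def topspace_eq_carrier[symmetric] by (intro openin_diff) auto
  moreover have "\<one> \<in> W" using i by (simp add: W_def)
  ultimately obtain V1 where V1: "openin T V1" "\<one> \<in> V1" "V1 \<subseteq> W"
    "\<And>x y. x \<in> V1 \<Longrightarrow> y \<in> V1 \<Longrightarrow> x \<otimes> y \<in> W"
    using neighbourhood_square[of W] by blast
  \<comment> \<open>Two halvings: products of two elements of \<open>V\<close> lie in
    \<open>V1\<close>, and products of four lie in \<open>W\<close>.\<close>
  obtain V where V: "openin T V" "\<one> \<in> V" "V \<subseteq> V1" "\<And>x y. x \<in> V \<Longrightarrow> y \<in> V \<Longrightarrow> x \<otimes> y \<in> V1"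
    using neighbourhood_square[OF V1(1,2)] by blast
  have Vc: "V \<subseteq> carrier G" using V V1 W_def by blast
  have W_colour: "colour n x \<noteq> i" if "x \<in> W" "x \<in> H n" "x \<notin> H (Suc n)" for n x
  proof
    assume "colour n x = i"
    then have "x \<in> U i" using that unfolding U_def by blast
    then show False
      using that closure_of_subset[OF openin_subset[OF U_open]] unfolding W_def by blast
  qed
  have fin: "finite {A \<in> s n ` (V \<inter> H n). card A = k}" for n k
  proof (rule ccontr)
    assume inf: "infinite {A \<in> s n ` (V \<inter> H n). card A = k}"
    have "finite A \<and> card A = k" if "A \<in> {A \<in> s n ` (V \<inter> H n). card A = k}" for A
      using that s_fin Vc by blast
    from infinite_uniform_family_sym_diff[OF inf this] obtain A B C D m where
      ABCD: "A \<in> s n ` (V \<inter> H n)" "B \<in> s n ` (V \<inter> H n)" "C \<in> s n ` (V \<inter> H n)" "D \<in> s n ` (V \<inter> H n)"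
      and m: "m > 0" "card (sym_diff A B) = 2 * m"
        "card (sym_diff (sym_diff A B) (sym_diff C D)) = 4 * m" by blast
    obtain a b c d where abcd: "a \<in> V \<inter> H n" "b \<in> V \<inter> H n" "c \<in> V \<inter> H n" "d \<in> V \<inter> H n"
      and eq: "A = s n a" "B = s n b" "C = s n c" "D = s n d"
      using ABCD by (elim imageE)
    have car: "a \<in> carrier G" "b \<in> carrier G" "c \<in> carrier G" "d \<in> carrier G"
      using abcd Vc by blast+
    \<comment> \<open>Both \<open>y\<close> and \<open>z\<close> lie in \<open>W\<close> and outside
      \<open>H (Suc n)\<close>, so both avoid colour \<open>i\<close> and hence have the same
      colour. Their coordinate sets have sizes \<open>2 * m\<close> and \<open>4 * m\<close>, which
      forces opposite colours.\<close>
    define y z where "y = a \<otimes> b" and "z = (a \<otimes> b) \<otimes> (c \<otimes> d)"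
    have yc: "y \<in> carrier G" "z \<in> carrier G" using car by (simp_all add: y_def z_def)
    have yz: "y \<in> W" "z \<in> W" "y \<in> H n" "z \<in> H n"
      using abcd V V1 H_mult unfolding y_def z_def by auto
    have card: "card (s n y) = 2 * m" "card (s n z) = 2 * (2 * m)"
      using m car eq by (simp_all add: y_def z_def s_mult)
    have "s n y \<noteq> {}" "s n z \<noteq> {}" using card m(1) by auto
    then have "y \<notin> H (Suc n)" "z \<notin> H (Suc n)" using s_empty yc by blast+
    with yz W_colour have "colour n y \<noteq> i" "colour n z \<noteq> i" by blast+
    moreover have "multiplicity 2 (2 * (2 * m)) = Suc (multiplicity 2 (2 * m))"
      using m(1) by (intro multiplicity_times_same) auto
    then have "colour n z \<longleftrightarrow> \<not> colour n y" unfolding colour_def card by simp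
    ultimately show False by blast
  qed
  define S where "S n = \<Union>(s n ` (V \<inter> H n))" for n
  have S_count: "countable (S n)" for n
  proof -
    have "s n ` (V \<inter> H n) \<subseteq> (\<Union>k. {A \<in> s n ` (V \<inter> H n). card A = k})" by blast
    moreover have "countable \<dots>" using fin by (intro countable_UN) (auto intro: countable_finite)
    ultimately have "countable (s n ` (V \<inter> H n))" by (rule countable_subset)
    moreover have "countable A" if "A \<in> s n ` (V \<inter> H n)" for A
      using that s_fin Vc by (auto intro: countable_finite)
    ultimately show ?thesis
      using countable_UN[of "s n ` (V \<inter> H n)" "\<lambda>A. A"] by (simp add: S_def)
  qed
  \<comment> \<open>The relevant coordinates of each level are numbered injectively, which preserves
    symmetric differences. \<open>\<Phi>\<close> then packs all levels into one set of naturals, a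
    code \<open>k\<close> standing for a pair of level and coordinate.\<close>
  define c where "c n x = to_nat_on (S n) ` (s n x \<inter> S n)" for n x
  define \<Phi> where "\<Phi> x = {k. snd (prod_decode k) \<in> c (fst (prod_decode k)) x}" for x
  have c_mult: "c n (x \<otimes> y) = sym_diff (c n x) (c n y)"
    if "x \<in> carrier G" "y \<in> carrier G" for n x y
  proof -
    have inj: "inj_on (to_nat_on (S n)) (S n)" by (rule inj_on_to_nat_on[OF S_count])
    have diff: "to_nat_on (S n) ` (A \<inter> S n - B \<inter> S n) =
        to_nat_on (S n) ` (A \<inter> S n) - to_nat_on (S n) ` (B \<inter> S n)" for A B
      by (intro inj_on_image_set_diff[OF inj]) auto
    have "s n (x \<otimes> y) \<inter> S n = (s n x \<inter> S n - s n y \<inter> S n) \<union> (s n y \<inter> S n - s n x \<inter> S n)"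
      using s_mult[OF that] by blast
    then show ?thesis unfolding c_def by (simp only: image_Un diff)
  qed
  have "\<Phi> (x \<otimes> y) = sym_diff (\<Phi> x) (\<Phi> y)" if "x \<in> carrier G" "y \<in> carrier G" for x y
    unfolding \<Phi>_def c_mult[OF that] by blast
  moreover have "openin T {x \<in> carrier G. k \<in> \<Phi> x}" for k
  proof (rule openin_if_translation_closed[OF op H_one])
    fix x v assume x: "x \<in> {x \<in> carrier G. k \<in> \<Phi> x}" and v: "v \<in> H (Suc (fst (prod_decode k)))"
    then have "c (fst (prod_decode k)) (x \<otimes> v) = c (fst (prod_decode k)) x"
      unfolding c_def using s_translate by simp
    then show "x \<otimes> v \<in> {x \<in> carrier G. k \<in> \<Phi> x}"
      using x Hc[OF v] by (simp add: \<Phi>_def)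
  qed blast
  moreover have "\<not> openin T {x \<in> carrier G. \<Phi> x = {}}" (is "\<not> openin T ?K")
  proof
    assume K: "openin T ?K"
    \<comment> \<open>Climb the levels: for \<open>x\<close> in \<open>V\<close> and
      \<open>H n\<close> no coordinate of level \<open>n\<close> is lost in passing to
      \<open>S n\<close>, so an empty code puts \<open>x\<close> into
      \<open>H (Suc n)\<close>.\<close>
    have KV: "?K \<inter> V \<subseteq> (\<Inter>n. H n)"
    proof
      fix x assume x: "x \<in> ?K \<inter> V"
      have "x \<in> H n" for n
      proof (induction n)
        case 0
        then show ?case using x H0 by blast
      next
        case (Suc n)
        have "c n x = {}"
        proof (rule ccontr)
          assume "c n x \<noteq> {}"
          then obtain j where "j \<in> c n x" by blast
          then have "prod_encode (n, j) \<in> \<Phi> x" by (simp add: \<Phi>_def)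
          then show False using x by blast
        qed
        then have "s n x \<inter> S n = {}" by (simp add: c_def)
        moreover have "s n x \<subseteq> S n" unfolding S_def using x Suc by blast
        ultimately show ?case using s_empty x by blast
      qed
      then show "x \<in> (\<Inter>n. H n)" by blast
    qed
    have "c n \<one> = {}" for n using s_empty[of \<one> n] H_one by (simp add: c_def)
    then have "\<one> \<in> ?K \<inter> V" using V(2) by (simp add: \<Phi>_def)
    moreover have "subgroup (\<Inter>n. H n) G"
      by (rule subgroups_Inter) (use sub in auto)
    moreover have "openin T (?K \<inter> V)" by (rule openin_Int[OF K V(1)])
    ultimately have "openin T (\<Inter>n. H n)"
      using openin_subgroup KV by blast
    with nonopen show False by blast
  qed
  ultimately show ?thesis by blast
qed

end

section \<open>From a countable family of open subgroups to a topological group of sets of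
  naturals\<close>

theorem mainTheorem3:
  assumes "\<exists>(G :: 'a monoid) T.
      topological_group G T \<and> Hausdorff_space T \<and> extremally_disconnected_space T \<and>
      \<not> ulam_measurable |carrier G| \<and>
      (\<exists>\<H>. countable \<H> \<and> \<H> \<noteq> {} \<and> (\<forall>H \<in> \<H>. subgroup H G \<and> openin T H) \<and>
           \<not> openin T (\<Inter>\<H>))"
  shows "\<exists>(G :: nat set monoid) T.
      topological_group G T \<and> Hausdorff_space T \<and> extremally_disconnected_space T \<and>
      boolean_group G \<and> T \<noteq> discrete_topology (carrier G) \<and>
      |carrier G| \<le>o ctwo ^c natLeq"
proof -
  obtain G :: "'a monoid" and T \<H> where tg: "topological_group G T" and
    haus: "Hausdorff_space T" and ed: "extremally_disconnected_space T" and
    \<H>: "countable \<H>" "\<H> \<noteq> {}" "\<And>H. H \<in> \<H> \<Longrightarrow> subgroup H G \<and> openin T H" and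
    nonopen: "\<not> openin T (\<Inter>\<H>)"
    using assms by (elim exE conjE) blast
  interpret topological_group G T by (rule tg)
  obtain B where B: "subgroup B G" "openin T B" and invol: "\<And>x. x \<in> B \<Longrightarrow> x \<otimes>\<^bsub>G\<^esub> x = \<one>\<^bsub>G\<^esub>"
    using open_involutive_subgroup_exists[OF haus ed] by blast
  let ?G = "G\<lparr>carrier := B\<rparr>" and ?T = "subtopology T B"
  interpret GB: topological_group ?G ?T by (rule topological_group_subgroup[OF B(1)])
  have edB: "extremally_disconnected_space ?T"
    by (rule extremally_disconnected_space_open_subtopology[OF ed B(2)])
  have openB: "openin ?T A \<longleftrightarrow> openin T A \<and> A \<subseteq> B" for A
    by (rule openin_open_subtopology[OF B(2)])
  define E where "E = from_nat_into \<H>"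
  have E: "range E = \<H>" unfolding E_def using \<H> by (simp add: range_from_nat_into)
  \<comment> \<open>Finite partial intersections inside \<open>B\<close>. The strict bound makes
    \<open>H 0\<close> equal to \<open>B\<close>, the carrier of the subgroup.\<close>
  define H where "H n = B \<inter> (\<Inter>i<n. E i)" for n
  have H_Suc: "H (Suc n) = H n \<inter> E n" for n
    by (auto simp: H_def less_Suc_eq)
  have "subgroup (H n) G \<and> openin T (H n)" for n
  proof (induction n)
    case 0
    then show ?case using B by (simp add: H_def)
  next
    case (Suc n)
    then show ?case using \<H>(3)[of "E n"] E subgroups_Inter_pair unfolding H_Suc by blast
  qed
  then have H: "subgroup (H n) ?G" "openin ?T (H n)" for n
    using subgroup_incl[OF _ B(1)] openB by (auto simp: H_def)
  have Int: "(\<Inter>n. H n) = B \<inter> \<Inter>\<H>" unfolding H_def E[symmetric] by blast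
  have "\<not> openin ?T (\<Inter>n. H n)"
  proof
    assume "openin ?T (\<Inter>n. H n)"
    then have "openin T (B \<inter> \<Inter>\<H>)" unfolding Int openB by blast
    \<comment> \<open>Intersecting with the open subgroup \<open>B\<close> cannot make the
      intersection open, because a subgroup containing an open neighbourhood of the identity is
      itself open.\<close>
    moreover have sub: "subgroup (\<Inter>\<H>) G" using \<H> by (intro subgroups_Inter) auto
    ultimately have "openin T (\<Inter>\<H>)"
      using subgroup.one_closed[OF B(1)] subgroup.one_closed[OF sub]
      by (intro openin_subgroup[OF sub, of "B \<inter> \<Inter>\<H>"]) blast+
    with nonopen show False by blast
  qed
  then have "\<exists>\<Phi> :: 'a \<Rightarrow> nat set.
      (\<forall>x\<in>carrier ?G. \<forall>y\<in>carrier ?G. \<Phi> (x \<otimes>\<^bsub>?G\<^esub> y) = sym_diff (\<Phi> x) (\<Phi> y)) \<and>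
      (\<forall>j. openin ?T {x \<in> carrier ?G. j \<in> \<Phi> x}) \<and> \<not> openin ?T {x \<in> carrier ?G. \<Phi> x = {}}"
    by (intro GB.countable_coordinates_of_nonopen_Inter[OF edB, of H] H)
      (simp_all add: H_Suc invol, simp add: H_def)
  then obtain \<Phi> :: "'a \<Rightarrow> nat set" where \<Phi>:
    "(\<forall>x\<in>carrier ?G. \<forall>y\<in>carrier ?G. \<Phi> (x \<otimes>\<^bsub>?G\<^esub> y) = sym_diff (\<Phi> x) (\<Phi> y)) \<and>
      (\<forall>j. openin ?T {x \<in> carrier ?G. j \<in> \<Phi> x}) \<and> \<not> openin ?T {x \<in> carrier ?G. \<Phi> x = {}}"
    by (rule exE)
  have "\<exists>(Q :: nat set monoid) S.
      topological_group Q S \<and> Hausdorff_space S \<and> extremally_disconnected_space S \<and>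
      boolean_group Q \<and> S \<noteq> discrete_topology (carrier Q)"
    by (rule GB.boolean_image_of_extremally_disconnected[OF edB, of \<Phi>]) (use \<Phi> in simp_all)
  then obtain Q :: "nat set monoid" and S where
    "topological_group Q S" "Hausdorff_space S" "extremally_disconnected_space S"
    "boolean_group Q" "S \<noteq> discrete_topology (carrier Q)" by blast
  moreover have "|carrier Q| \<le>o ctwo ^c natLeq"
  proof -
    have "|carrier Q| \<le>o |Pow (UNIV :: nat set)|" by (simp add: card_of_mono1)
    also have "|Pow (UNIV :: nat set)| =o ctwo ^c natLeq"
      unfolding ctwo_def cexp_def Field_card_of Field_natLeq by (rule card_of_Pow_Func)
    finally show ?thesis .
  qed
  ultimately show ?thesis by blast
qed

end
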